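(* Let $M$ be a monoid, $X$ a null semigroup (i.e. there is an element $0\in X$ with $xy=0$ for all $x,y\in X$) and $\alpha$ a strong partial action of $M$ on $X$. Then the rewriting system $(X_M^+,\to)$ associated with $\alpha$ is locally confluent.
   Context: Let $M$ be a monoid with identity $e$. A strong partial action of $M$ on a set $X$ is a family $\alpha=\{\alpha_m:\operatorname{dom}\alpha_m\to X\}_{m\in M}$ of maps with $\operatorname{dom}\alpha_m\subseteq X$ such that: (1) $\operatorname{dom}\alpha_e=X$ and $\alpha_e=\mathrm{id}_X$; (2) $\alpha_m^{-1}(\operatorname{dom}\alpha_n)=\operatorname{dom}\alpha_{nm}\cap\operatorname{dom}\alpha_m$ for all $m,n\in M$; (3) $\alpha_n\circ\alpha_m=\alpha_{nm}$ on $\alpha_m^{-1}(\operatorname{dom}\alpha_n)$ for all $m,n\in M$. A strong partial action of $M$ on a semigroup $X$ is one on the underlying set such that each $\operatorname{dom}\alpha_m$ is a (possibly empty) subsemigroup of $X$ and each $\alpha_m$ is a semigroup homomorphism. $X_M=(M\times X)/{\approx}$, where $\approx$ is the equivalence relation generated by: $(m,x)\rightharpoonup(n,y)$ iff there is $k\in M$ with $m=nk$, $x\in\operatorname{dom}\alpha_k$ and $y=\alpha_k(x)$. The class of $(m,x)$ is $[m,x]$. $X_M^+$ is the free semigroup on $X_M$ (nonempty words), $X_M^*$ the free monoid. The relation $\to$ on $X_M^+$ is: $u[m,x][m,y]v\to u[m,xy]v$ for all $u,v\in X_M^*$, $m\in M$, $x,y\in X$. $\overset{*}{\to}$ is the reflexive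 transitive closure of $\to$. A word $w$ is locally confluent if whenever $w\to w_1$ and $w\to w_2$ there is $w'$ with $w_1\overset{*}{\to}w'$ and $w_2\overset{*}{\to}w'$; $(X_M^+,\to)$ is locally confluent if every word is. *)

theory Defs
  imports Main
begin

text \<open>
  The monoid \<open>M\<close> is a type \<open>'m\<close> of class \<^class>\<open>monoid_mult\<close>, the semigroup \<open>X\<close> a type \<open>'x\<close> of class
  \<^class>\<open>semigroup_mult\<close>. A family of partially defined maps on \<open>X\<close> is a family of HOL maps
  \<open>'x \<rightharpoonup> 'x\<close>, with \<open>dom (\<alpha> m)\<close> as the domain of \<open>\<alpha>\<^sub>m\<close>.
\<close>

definition pre_dom :: "('m \<Rightarrow> 'x \<rightharpoonup> 'x) \<Rightarrow> 'm \<Rightarrow> 'm \<Rightarrow> 'x set" where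
  \<comment> \<open>\<open>pre_dom \<alpha> m n\<close> is the preimage of \<open>dom (\<alpha> n)\<close> under the partial map \<open>\<alpha> m\<close>.\<close>
  "pre_dom \<alpha> m n = {x \<in> dom (\<alpha> m). the (\<alpha> m x) \<in> dom (\<alpha> n)}"

definition strong_partial_action :: "('m::monoid_mult \<Rightarrow> 'x \<rightharpoonup> 'x) \<Rightarrow> bool" where
  "strong_partial_action \<alpha> \<longleftrightarrow>
     dom (\<alpha> 1) = UNIV \<and> (\<forall>x. \<alpha> 1 x = Some x) \<and>
     (\<forall>m n. pre_dom \<alpha> m n = dom (\<alpha> (n * m)) \<inter> dom (\<alpha> m)) \<and>
     (\<forall>m n. \<forall>x \<in> pre_dom \<alpha> m n. \<alpha> n (the (\<alpha> m x)) = \<alpha> (n * m) x)"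

definition subsemigroup :: "'x::semigroup_mult set \<Rightarrow> bool" where
  \<comment> \<open>The empty set is allowed.\<close>
  "subsemigroup S \<longleftrightarrow> (\<forall>x \<in> S. \<forall>y \<in> S. x * y \<in> S)"

definition semigroup_strong_partial_action ::
    "('m::monoid_mult \<Rightarrow> 'x::semigroup_mult \<rightharpoonup> 'x) \<Rightarrow> bool" where
  "semigroup_strong_partial_action \<alpha> \<longleftrightarrow>
     strong_partial_action \<alpha> \<and>
     (\<forall>m. subsemigroup (dom (\<alpha> m))) \<and>
     (\<forall>m. \<forall>x \<in> dom (\<alpha> m). \<forall>y \<in> dom (\<alpha> m).
        the (\<alpha> m (x * y)) = the (\<alpha> m x) * the (\<alpha> m y))"

definition glob_step :: "('m::monoid_mult \<Rightarrow> 'x \<rightharpoonup> 'x) \<Rightarrow> 'm \<times> 'x \<Rightarrow> 'm \<times> 'x \<Rightarrow> bool" where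
  "glob_step \<alpha> = (\<lambda>(m, x) (n, y). \<exists>k. m = n * k \<and> x \<in> dom (\<alpha> k) \<and> y = the (\<alpha> k x))"

definition glob_rel :: "('m::monoid_mult \<Rightarrow> 'x \<rightharpoonup> 'x) \<Rightarrow> (('m \<times> 'x) \<times> ('m \<times> 'x)) set" where
  "glob_rel \<alpha> = {(p, q). equivclp (glob_step \<alpha>) p q}"

definition glob :: "('m::monoid_mult \<Rightarrow> 'x \<rightharpoonup> 'x) \<Rightarrow> ('m \<times> 'x) set set" where
  \<comment> \<open>The set \<open>X\<^sub>M\<close>.\<close>
  "glob \<alpha> = UNIV // glob_rel \<alpha>"

definition glob_class :: "('m::monoid_mult \<Rightarrow> 'x \<rightharpoonup> 'x) \<Rightarrow> 'm \<Rightarrow> 'x \<Rightarrow> ('m \<times> 'x) set" where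
  \<comment> \<open>The class \<open>[m, x]\<close>.\<close>
  "glob_class \<alpha> m x = glob_rel \<alpha> `` {(m, x)}"

definition free_semigroup :: "'a set \<Rightarrow> 'a list set" where
  "free_semigroup A = lists A - {[]}"

inductive rewrite ::
    "('m::monoid_mult \<Rightarrow> 'x::semigroup_mult \<rightharpoonup> 'x) \<Rightarrow>
     ('m \<times> 'x) set list \<Rightarrow> ('m \<times> 'x) set list \<Rightarrow> bool"
  for \<alpha> where
  "u \<in> lists (glob \<alpha>) \<Longrightarrow> v \<in> lists (glob \<alpha>) \<Longrightarrow>
   rewrite \<alpha> (u @ [glob_class \<alpha> m x, glob_class \<alpha> m y] @ v) (u @ [glob_class \<alpha> m (x * y)] @ v)"

definition word_locally_confluent :: "('w \<Rightarrow> 'w \<Rightarrow> bool) \<Rightarrow> 'w \<Rightarrow> bool" where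
  "word_locally_confluent r w \<longleftrightarrow>
     (\<forall>w1 w2. r w w1 \<and> r w w2 \<longrightarrow> (\<exists>w'. r\<^sup>*\<^sup>* w1 w' \<and> r\<^sup>*\<^sup>* w2 w'))"

definition locally_confluent_on :: "'w set \<Rightarrow> ('w \<Rightarrow> 'w \<Rightarrow> bool) \<Rightarrow> bool" where
  \<comment> \<open>Intended for relations \<open>r\<close> on \<open>W\<close>, whose reducts stay in \<open>W\<close>.\<close>
  "locally_confluent_on W r \<longleftrightarrow> (\<forall>w \<in> W. word_locally_confluent r w)"

lemma glob_class_in_glob: "glob_class \<alpha> m x \<in> glob \<alpha>"
  by (auto simp: glob_class_def glob_def quotient_def)

lemma rewrite_free_semigroup:
  assumes "rewrite \<alpha> w w'"
  shows "w \<in> free_semigroup (glob \<alpha>)" "w' \<in> free_semigroup (glob \<alpha>)"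
  using assms by (auto elim!: rewrite.cases simp: free_semigroup_def glob_class_in_glob)

end

theory Submission
  imports Defs
begin

text \<open>
  Write \<open>0\<close> for the zero of \<open>X\<close>. A map \<open>\<alpha>\<^sub>k\<close> with nonempty domain fixes \<open>0\<close>, because
  \<open>x \<in> dom \<alpha>\<^sub>k\<close> gives \<open>0 = xx \<in> dom \<alpha>\<^sub>k\<close> and \<open>\<alpha>\<^sub>k(0) = \<alpha>\<^sub>k(x)\<alpha>\<^sub>k(x) = 0\<close>.
  Hence \<open>[m,x] = [n,y]\<close> implies \<open>[m,0] = [n,0]\<close>: the result of contracting two adjacent letters
  is determined by either of them. In an overlap \<open>[m,x][m,y][n,t]\<close> with \<open>[m,y] = [n,s]\<close> both
  contractions therefore lead, after one more step, to \<open>[m,0] = [n,0]\<close>.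
\<close>

lemma glob_class_eq_iff:
  "glob_class \<alpha> m x = glob_class \<alpha> n y \<longleftrightarrow> equivclp (glob_step \<alpha>) (m, x) (n, y)"
proof -
  have "equiv UNIV (glob_rel \<alpha>)"
    unfolding glob_rel_def
    by (auto intro!: equivI refl_onI symI transI intro: equivclp_sym equivclp_trans)
  then show ?thesis
    unfolding glob_class_def by (subst eq_equiv_class_iff) (auto simp: glob_rel_def)
qed

text \<open>The same \<open>k\<close> witnesses both steps: squaring \<open>snd p\<close> shows that
  \<open>z\<close> lies in the domain of \<open>\<alpha> k\<close> and is fixed by it.\<close>

lemma glob_step_zero:
  fixes \<alpha> :: "'m::monoid_mult \<Rightarrow> 'x::semigroup_mult \<rightharpoonup> 'x"
  assumes null: "\<And>x y::'x. x * y = z"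
    and action: "semigroup_strong_partial_action \<alpha>"
    and step: "glob_step \<alpha> p q"
  shows "glob_step \<alpha> (fst p, z) (fst q, z)"
proof -
  obtain k where k: "fst p = fst q * k" "snd p \<in> dom (\<alpha> k)"
    using step by (auto simp: glob_step_def split: prod.splits)
  have "snd p * snd p \<in> dom (\<alpha> k)"
    using action k(2) by (simp add: semigroup_strong_partial_action_def subsemigroup_def)
  moreover have "the (\<alpha> k (snd p * snd p)) = the (\<alpha> k (snd p)) * the (\<alpha> k (snd p))"
    using action k(2) by (simp add: semigroup_strong_partial_action_def)
  ultimately have "z \<in> dom (\<alpha> k)" "z = the (\<alpha> k z)"
    by (simp_all add: null)
  with k(1) show ?thesis
    unfolding glob_step_def by auto
qed

lemma glob_class_zero_cong:
  fixes \<alpha> :: "'m::monoid_mult \<Rightarrow> 'x::semigroup_mult \<rightharpoonup> 'x"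
  assumes null: "\<And>x y::'x. x * y = z"
    and action: "semigroup_strong_partial_action \<alpha>"
    and eq: "glob_class \<alpha> m x = glob_class \<alpha> n y"
  shows "glob_class \<alpha> m z = glob_class \<alpha> n z"
proof -
  \<comment> \<open>Replacing second components by \<open>z\<close> preserves each link of a zigzag
    of steps, in either direction.\<close>
  have "equivclp (glob_step \<alpha>) p q \<Longrightarrow> equivclp (glob_step \<alpha>) (fst p, z) (fst q, z)" for p q
    by (induction rule: equivclp_induct)
      (auto intro: equivclp_into_equivclp
        dest: glob_step_zero[OF null action])
  from this[of "(m, x)" "(n, y)"] show ?thesis
    using eq by (simp add: glob_class_eq_iff)
qed

text \<open>By symmetry the redex after \<open>u\<close> may be taken to start no later than the one
  after \<open>u'\<close>; what matters is then the offset between the two.\<close>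

lemma rewrite_joinable:
  fixes \<alpha> :: "'m::monoid_mult \<Rightarrow> 'x::semigroup_mult \<rightharpoonup> 'x"
  assumes null: "\<And>x y::'x. x * y = z"
    and action: "semigroup_strong_partial_action \<alpha>"
    and lists: "u \<in> lists (glob \<alpha>)" "v \<in> lists (glob \<alpha>)"
      "u' \<in> lists (glob \<alpha>)" "v' \<in> lists (glob \<alpha>)"
    and eq: "u @ [glob_class \<alpha> m x, glob_class \<alpha> m y] @ v
      = u' @ [glob_class \<alpha> n s, glob_class \<alpha> n t] @ v'"
    and le: "length u \<le> length u'"
  shows "\<exists>w. (rewrite \<alpha>)\<^sup>*\<^sup>* (u @ [glob_class \<alpha> m (x * y)] @ v) w \<and>
    (rewrite \<alpha>)\<^sup>*\<^sup>* (u' @ [glob_class \<alpha> n (s * t)] @ v') w"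
proof -
  note contract = rewrite.intros[where \<alpha> = \<alpha>, unfolded null]
  obtain d where d: "u' = u @ d"
    "glob_class \<alpha> m x # glob_class \<alpha> m y # v = d @ glob_class \<alpha> n s # glob_class \<alpha> n t # v'"
    using eq le by (auto simp: append_eq_append_conv2)
  \<comment> \<open>The length of \<open>d\<close> is the offset: 0 for the same pair of letters, 1
    for a shared letter, at least 2 for disjoint redexes.\<close>
  consider "d = []" | a where "d = [a]" | a b r where "d = a # b # r"
    by (metis neq_Nil_conv)
  then show ?thesis
  proof cases
    case 1
    \<comment> \<open>One pair of letters may have different representatives, so the two reducts
      still have to be identified.\<close>
    with d have "glob_class \<alpha> m x = glob_class \<alpha> n s" "v = v'" "u' = u"
      by auto
    with glob_class_zero_cong[OF null action] show ?thesis
      by (metis null rtranclp.rtrancl_refl)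
  next
    case 2
    with d have v: "v = glob_class \<alpha> n t # v'" and u': "u' = u @ [glob_class \<alpha> m x]"
      and "glob_class \<alpha> m y = glob_class \<alpha> n s"
      by auto
    then have zero: "glob_class \<alpha> m z = glob_class \<alpha> n z"
      using glob_class_zero_cong[OF null action] by blast
    \<comment> \<open>Reading \<open>[m,z]\<close> as \<open>[n,z]\<close> gives it the same monoid
      component as its neighbour \<open>[n,t]\<close>, so the two contract.\<close>
    have "rewrite \<alpha> (u @ [glob_class \<alpha> m z] @ v) (u @ [glob_class \<alpha> n z] @ v')"
      using contract[of u v' n z t] lists by (simp add: v zero)
    moreover have "rewrite \<alpha> (u' @ [glob_class \<alpha> n z] @ v') (u @ [glob_class \<alpha> n z] @ v')"
      using contract[of u v' m x z] lists by (simp add: u' zero)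
    ultimately show ?thesis
      unfolding null by blast
  next
    case 3
    with d have v: "v = r @ [glob_class \<alpha> n s, glob_class \<alpha> n t] @ v'"
      and u': "u' = u @ [glob_class \<alpha> m x, glob_class \<alpha> m y] @ r"
      by auto
    have r: "r \<in> lists (glob \<alpha>)"
      using lists u' by simp
    \<comment> \<open>Disjoint redexes commute: \<open>?w\<close> has both contracted, with
      \<open>r\<close> untouched between them.\<close>
    let ?w = "u @ [glob_class \<alpha> m z] @ r @ [glob_class \<alpha> n z] @ v'"
    have "rewrite \<alpha> (u @ [glob_class \<alpha> m z] @ v) ?w"
      using contract[of "u @ [glob_class \<alpha> m z] @ r" v' n s t] lists r
      by (simp add: v glob_class_in_glob)
    moreover have "rewrite \<alpha> (u' @ [glob_class \<alpha> n z] @ v') ?w"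
      using contract[of u "r @ [glob_class \<alpha> n z] @ v'" m x y] lists r
      by (simp add: u' glob_class_in_glob)
    ultimately show ?thesis
      unfolding null by blast
  qed
qed

theorem proposition4p21:
  fixes \<alpha> :: "'m::monoid_mult \<Rightarrow> 'x::semigroup_mult \<rightharpoonup> 'x"
  assumes null: "\<exists>z::'x. \<forall>x y::'x. x * y = z"
    and action: "semigroup_strong_partial_action \<alpha>"
  shows "locally_confluent_on (free_semigroup (glob \<alpha>)) (rewrite \<alpha>)"
proof -
  obtain z :: 'x where z: "\<And>x y::'x. x * y = z"
    using null by blast
  have "\<exists>w'. (rewrite \<alpha>)\<^sup>*\<^sup>* w1 w' \<and> (rewrite \<alpha>)\<^sup>*\<^sup>* w2 w'"
    if "rewrite \<alpha> w w1" "rewrite \<alpha> w w2" for w w1 w2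
    using that(1)
  proof cases
    case left: (1 u v m x y)
    from that(2) show ?thesis
    proof cases
      case right: (1 u' v' n s t)
      note eq = left(1)[unfolded right(1)]
      show ?thesis
      proof (cases "length u \<le> length u'")
        case True
        then show ?thesis
          using rewrite_joinable[OF z action left(3,4) right(3,4) eq[symmetric]] left(2) right(2)
          by simp
      next
        case False
        then show ?thesis
          \<comment> \<open>The right redex starts first, so the two reductions swap roles.\<close>
          using rewrite_joinable[OF z action right(3,4) left(3,4) eq] left(2) right(2)
          by auto
      qed
    qed
  qed
  then show ?thesis
    unfolding locally_confluent_on_def word_locally_confluent_def by blast
qed

end
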